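(* Let $G$ be a finite group and let $Max_G=\{x_1,\dots,x_m\}$ be an essential cyclic set of $G$. If $icn(G)=1$, then $rc(\Gamma_G^e)=1$ if and only if $m=1$. In particular, if $|InMax_G|=1$, then $rc(\Gamma_G^e)=1$ if and only if $G\cong\mathbb{Z}_2$.
   Context: Let $G$ be a finite group with identity $e$. The enhanced power graph $\Gamma_G^e$ has vertex set $G$, two distinct vertices $x,y$ being adjacent iff $x,y\in\langle z\rangle$ for some $z\in G$. For a connected graph $\Gamma$, an edge-colouring $\zeta:E(\Gamma)\to\{1,\dots,k\}$ (not necessarily proper) is a rainbow $k$-colouring if every pair of distinct vertices is joined by a path whose edges have pairwise distinct colours; the rainbow connection number $rc(\Gamma)$ is the minimum such $k$. An essential cyclic set $Max_G=\{x_1,\dots,x_m\}$ is a set of elements of $G$ such that $\langle x_1\rangle,\dots,\langle x_m\rangle$ are pairwise distinct and are exactly the maximal cyclic subgroups of $G$ (so every cyclic subgroup of $G$ lies in some $\langle x_i\rangle$, and $m=|Max_G|$ is the number of maximal cyclic subgroups). The independence cyclic set is $ics(G)=\{x_i\in Max_G:\langle x_i\rangle\cap\langle x_j\rangle=\{e\}\text{ for all }j\neq i\}$ and $icn(G)=|ics(G)|$. $InMax_G$ denotes the set of maximal involutions of $G$, i.e. involutions $t\in G$ such that $\langle t\rangle$ is a maximal cyclic subgroup of $G$. *)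

theory Defs
  imports "HOL-Algebra.Algebra" "HOL-Algebra.Elementary_Groups" "Graph_Theory.Graph_Theory"
begin

text \<open>
  An undirected simple graph is represented, as in the Graph_Theory entry, by a symmetric
  loop-free pair digraph (locale \<^locale>\<open>pair_graph\<close>).  An undirected edge is the set of the two
  ends of an arc, so that a colouring of edges cannot distinguish an arc from its reverse.
\<close>

definition edges :: "'v pair_pre_digraph \<Rightarrow> 'v set set" where
  "edges \<Gamma> = {{u, v} | u v. (u, v) \<in> parcs \<Gamma>}"

definition rainbow_path ::
    "'v pair_pre_digraph \<Rightarrow> ('v set \<Rightarrow> nat) \<Rightarrow> 'v \<Rightarrow> ('v \<times> 'v) awalk \<Rightarrow> 'v \<Rightarrow> bool" where
  "rainbow_path \<Gamma> \<zeta> u p v \<longleftrightarrow>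
     pre_digraph.apath (with_proj \<Gamma>) u p v \<and> distinct (map (\<lambda>(a, b). \<zeta> {a, b}) p)"

definition rainbow_colouring :: "'v pair_pre_digraph \<Rightarrow> nat \<Rightarrow> ('v set \<Rightarrow> nat) \<Rightarrow> bool" where
  "rainbow_colouring \<Gamma> k \<zeta> \<longleftrightarrow>
     \<zeta> \<in> edges \<Gamma> \<rightarrow> {1..k} \<and>
     (\<forall>u \<in> pverts \<Gamma>. \<forall>v \<in> pverts \<Gamma>. u \<noteq> v \<longrightarrow> (\<exists>p. rainbow_path \<Gamma> \<zeta> u p v))"

text \<open>
  The colour set \<open>{1, \<dots>, k}\<close> is nonempty, i.e. \<open>k \<ge> 1\<close>.  This matters only for the one-vertex
  graph, which has no edges and whose rainbow connection number is 1 under this convention.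
  The definition is meaningful for connected graphs only.
\<close>

definition rainbow_connection_number :: "'v pair_pre_digraph \<Rightarrow> nat" where
  "rainbow_connection_number \<Gamma> = (LEAST k. 1 \<le> k \<and> (\<exists>\<zeta>. rainbow_colouring \<Gamma> k \<zeta>))"

definition enhanced_power_graph :: "('a, 'b) monoid_scheme \<Rightarrow> 'a pair_pre_digraph" where
  "enhanced_power_graph G =
     \<lparr> pverts = carrier G,
       parcs = {(x, y). x \<in> carrier G \<and> y \<in> carrier G \<and> x \<noteq> y \<and>
                        (\<exists>z \<in> carrier G. x \<in> generate G {z} \<and> y \<in> generate G {z})} \<rparr>"

definition cyclic_subgroups :: "('a, 'b) monoid_scheme \<Rightarrow> 'a set set" where
  "cyclic_subgroups G = {generate G {x} | x. x \<in> carrier G}"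

definition maximal_cyclic_subgroups :: "('a, 'b) monoid_scheme \<Rightarrow> 'a set set" where
  "maximal_cyclic_subgroups G =
     {H \<in> cyclic_subgroups G. \<forall>K \<in> cyclic_subgroups G. H \<subseteq> K \<longrightarrow> K = H}"

definition essential_cyclic_set :: "('a, 'b) monoid_scheme \<Rightarrow> 'a set \<Rightarrow> bool" where
  "essential_cyclic_set G M \<longleftrightarrow>
     M \<subseteq> carrier G \<and> bij_betw (\<lambda>x. generate G {x}) M (maximal_cyclic_subgroups G)"

text \<open>
  The set \<open>ics\<close> depends on the chosen essential cyclic set \<open>M\<close>, its cardinality \<open>icn\<close> does not.
\<close>

definition ics :: "('a, 'b) monoid_scheme \<Rightarrow> 'a set \<Rightarrow> 'a set" where
  "ics G M = {x \<in> M. \<forall>y \<in> M. y \<noteq> x \<longrightarrow> generate G {x} \<inter> generate G {y} = {\<one>\<^bsub>G\<^esub>}}"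

definition icn :: "('a, 'b) monoid_scheme \<Rightarrow> 'a set \<Rightarrow> nat" where
  "icn G M = card (ics G M)"

definition maximal_involutions :: "('a, 'b) monoid_scheme \<Rightarrow> 'a set" where
  "maximal_involutions G =
     {t \<in> carrier G. group.ord G t = 2 \<and> generate G {t} \<in> maximal_cyclic_subgroups G}"

lemma pair_graph_enhanced_power_graph:
  assumes "finite (carrier G)"
  shows "pair_graph (enhanced_power_graph G)"
proof -
  have "finite (parcs (enhanced_power_graph G))"
    by (rule finite_subset[of _ "carrier G \<times> carrier G"])
       (use assms in \<open>auto simp: enhanced_power_graph_def\<close>)
  then show ?thesis
    using assms
    by unfold_locales
       (auto simp: enhanced_power_graph_def symmetric_def arcs_ends_conv image_def intro!: symI)
qed

text \<open>
  Every vertex other than the identity is adjacent to it, so a colouring that is injective on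
  edges is a rainbow colouring.  Hence the minimum defining the rainbow connection number of the
  enhanced power graph is attained.
\<close>

lemma rainbow_colouring_enhanced_power_graph_exists:
  assumes "group G" "finite (carrier G)"
  shows "\<exists>k \<ge> 1. \<exists>\<zeta>. rainbow_colouring (enhanced_power_graph G) k \<zeta>"
proof -
  let ?\<Gamma> = "enhanced_power_graph G"
  interpret group G by fact
  interpret pair_graph ?\<Gamma> by (rule pair_graph_enhanced_power_graph) fact
  have pv: "pverts ?\<Gamma> = carrier G" by (simp add: enhanced_power_graph_def)
  have e: "(x, \<one>\<^bsub>G\<^esub>) \<in> parcs ?\<Gamma>" "(\<one>\<^bsub>G\<^esub>, x) \<in> parcs ?\<Gamma>" if "x \<in> carrier G" "x \<noteq> \<one>\<^bsub>G\<^esub>" for x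
    using that by (auto simp: enhanced_power_graph_def intro: generate.intros)
  have "edges ?\<Gamma> \<subseteq> Pow (carrier G)"
    by (auto simp: edges_def enhanced_power_graph_def)
  then have fin: "finite (edges ?\<Gamma>)"
    using assms(2) by (meson finite_Pow_iff finite_subset)
  then obtain f :: "'a set \<Rightarrow> nat" where f: "bij_betw f (edges ?\<Gamma>) {1..card (edges ?\<Gamma>)}"
    using ex_bij_betw_finite_nat ex_bij_betw_nat_finite_1 bij_betw_inv by metis
  have inj: "f E = f F \<longleftrightarrow> E = F" if "E \<in> edges ?\<Gamma>" "F \<in> edges ?\<Gamma>" for E F
    using f that by (auto simp: bij_betw_def inj_on_def)
  have ed: "{x, \<one>\<^bsub>G\<^esub>} \<in> edges ?\<Gamma>" if "x \<in> carrier G" "x \<noteq> \<one>\<^bsub>G\<^esub>" for x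
    using e[OF that] by (auto simp: edges_def)
  have "\<exists>p. rainbow_path ?\<Gamma> f u p v" if uv: "u \<in> carrier G" "v \<in> carrier G" "u \<noteq> v" for u v
  proof -
    consider "u = \<one>\<^bsub>G\<^esub>" | "v = \<one>\<^bsub>G\<^esub>" | "u \<noteq> \<one>\<^bsub>G\<^esub>" "v \<noteq> \<one>\<^bsub>G\<^esub>" by blast
    then show ?thesis
    proof cases
      case 3
      have "f {u, \<one>\<^bsub>G\<^esub>} \<noteq> f {\<one>\<^bsub>G\<^esub>, v}"
        using inj[OF ed[of u] ed[of v]] uv 3 by (auto simp: doubleton_eq_iff insert_commute)
      then have "rainbow_path ?\<Gamma> f u [(u, \<one>\<^bsub>G\<^esub>), (\<one>\<^bsub>G\<^esub>, v)] v"
        using uv 3 e[of u] e[of v]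
        by (auto simp: rainbow_path_def apath_def awalk_def pv)
      then show ?thesis by blast
    next
      case 1
      then have "rainbow_path ?\<Gamma> f u [(u, v)] v"
        using uv e[of v] by (auto simp: rainbow_path_def apath_def awalk_def pv)
      then show ?thesis by blast
    next
      case 2
      then have "rainbow_path ?\<Gamma> f u [(u, v)] v"
        using uv e[of u] by (auto simp: rainbow_path_def apath_def awalk_def pv)
      then show ?thesis by blast
    qed
  qed
  moreover have "f \<in> edges ?\<Gamma> \<rightarrow> {1..Suc (card (edges ?\<Gamma>))}"
    using bij_betwE[OF f] by fastforce
  ultimately have "rainbow_colouring ?\<Gamma> (Suc (card (edges ?\<Gamma>))) f"
    by (simp add: rainbow_colouring_def pv)
  then show ?thesis by force
qed

end

theory Submission
  imports Defs
begin

text \<open>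
  A rainbow path in a graph with a single colour has at most one edge, so the rainbow connection
  number is 1 exactly when the graph is complete.  If the enhanced power graph is complete, two
  generators of maximal cyclic subgroups lie in a common cyclic subgroup, which by maximality
  equals both; hence there is only one maximal cyclic subgroup.  Conversely, a unique maximal cyclic
  subgroup contains every element and is therefore the whole group.
\<close>

text \<open>Distinctness of the colours along a walk bounds its length by the number of colours, so
  with one colour only direct edges remain.\<close>

lemma rainbow_colouring_one_iff_complete:
  assumes "pair_graph \<Gamma>"
  shows "(\<exists>\<zeta>. rainbow_colouring \<Gamma> 1 \<zeta>) \<longleftrightarrow>
         (\<forall>u \<in> pverts \<Gamma>. \<forall>v \<in> pverts \<Gamma>. u \<noteq> v \<longrightarrow> (u, v) \<in> parcs \<Gamma>)"
proof
  interpret pair_graph \<Gamma> by fact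
  assume "\<exists>\<zeta>. rainbow_colouring \<Gamma> 1 \<zeta>"
  then obtain \<zeta> where \<zeta>: "rainbow_colouring \<Gamma> 1 \<zeta>" ..
  \<comment> \<open>The colour set \<open>{1..1}\<close> is a singleton.\<close>
  have col: "\<zeta> {a, b} = 1" if "(a, b) \<in> parcs \<Gamma>" for a b
    using \<zeta> that by (auto simp: rainbow_colouring_def edges_def Pi_iff)
  show "\<forall>u \<in> pverts \<Gamma>. \<forall>v \<in> pverts \<Gamma>. u \<noteq> v \<longrightarrow> (u, v) \<in> parcs \<Gamma>"
  proof (intro ballI impI)
    fix u v assume uv: "u \<in> pverts \<Gamma>" "v \<in> pverts \<Gamma>" "u \<noteq> v"
    then obtain p where p: "awalk u p v" "distinct (map (\<lambda>(a, b). \<zeta> {a, b}) p)"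
      using \<zeta> unfolding rainbow_colouring_def rainbow_path_def apath_def by blast
    have arcs: "set p \<subseteq> parcs \<Gamma>"
      using p(1) by (auto simp: awalk_def)
    show "(u, v) \<in> parcs \<Gamma>"
    proof (cases p)
      case Nil
      then show ?thesis using p uv by (auto simp: awalk_def)
    next
      case (Cons a q)
      show ?thesis
      proof (cases q)
        case Nil
        then show ?thesis using p Cons by (auto simp: awalk_def)
      next
        \<comment> \<open>The first two arcs of \<open>p\<close> would both have colour 1, against
          distinctness.\<close>
        case (Cons b r)
        then have False
          using p(2) arcs \<open>p = a # q\<close> col[of "fst a" "snd a"] col[of "fst b" "snd b"]
          by (auto simp: case_prod_beta)
        then show ?thesis ..
      qed
    qed
  qed
next
  interpret pair_graph \<Gamma> by fact
  assume complete: "\<forall>u \<in> pverts \<Gamma>. \<forall>v \<in> pverts \<Gamma>. u \<noteq> v \<longrightarrow> (u, v) \<in> parcs \<Gamma>"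
  \<comment> \<open>A path with a single edge is rainbow under every colouring, so a constant one
    suffices.\<close>
  have "rainbow_path \<Gamma> (\<lambda>_. 1) u [(u, v)] v"
    if "u \<in> pverts \<Gamma>" "v \<in> pverts \<Gamma>" "u \<noteq> v" for u v
    using that complete by (auto simp: rainbow_path_def apath_def awalk_def)
  then have "rainbow_colouring \<Gamma> 1 (\<lambda>_. 1)"
    by (auto simp: rainbow_colouring_def)
  then show "\<exists>\<zeta>. rainbow_colouring \<Gamma> 1 \<zeta>"
    by blast
qed

text \<open>The hypothesis makes the minimum attained, so that the value of \<open>LEAST\<close>
  really belongs to a rainbow colouring. The converse rests on the bound \<open>1 \<le> k\<close>
  inside the definition.\<close>

lemma rainbow_connection_number_eq_one_iff:
  assumes "\<exists>k \<ge> 1. \<exists>\<zeta>. rainbow_colouring \<Gamma> k \<zeta>"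
  shows "rainbow_connection_number \<Gamma> = 1 \<longleftrightarrow> (\<exists>\<zeta>. rainbow_colouring \<Gamma> 1 \<zeta>)"
proof
  assume "rainbow_connection_number \<Gamma> = 1"
  then show "\<exists>\<zeta>. rainbow_colouring \<Gamma> 1 \<zeta>"
    using LeastI_ex[of "\<lambda>k. 1 \<le> k \<and> (\<exists>\<zeta>. rainbow_colouring \<Gamma> k \<zeta>)"] assms
    by (simp add: rainbow_connection_number_def)
next
  assume "\<exists>\<zeta>. rainbow_colouring \<Gamma> 1 \<zeta>"
  then show "rainbow_connection_number \<Gamma> = 1"
    unfolding rainbow_connection_number_def by (intro Least_equality) auto
qed

lemma (in group) rainbow_connection_number_enhanced_power_graph_eq_one_iff:
  assumes "finite (carrier G)"
  shows "rainbow_connection_number (enhanced_power_graph G) = 1 \<longleftrightarrow>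
         (\<forall>x \<in> carrier G. \<forall>y \<in> carrier G. \<exists>z \<in> carrier G.
            x \<in> generate G {z} \<and> y \<in> generate G {z})"
proof -
  have "(\<forall>u \<in> pverts (enhanced_power_graph G). \<forall>v \<in> pverts (enhanced_power_graph G).
           u \<noteq> v \<longrightarrow> (u, v) \<in> parcs (enhanced_power_graph G)) \<longleftrightarrow>
        (\<forall>x \<in> carrier G. \<forall>y \<in> carrier G. \<exists>z \<in> carrier G.
           x \<in> generate G {z} \<and> y \<in> generate G {z})"
    \<comment> \<open>Adjacency concerns distinct vertices only; for \<open>x = y\<close> the
      witness \<open>z = x\<close> works.\<close>
    by (simp add: enhanced_power_graph_def) (metis generate.incl singletonI)
  then show ?thesis
    by (simp only: rainbow_connection_number_eq_one_iff
        [OF rainbow_colouring_enhanced_power_graph_exists[OF is_group assms]]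
        rainbow_colouring_one_iff_complete[OF pair_graph_enhanced_power_graph[OF assms]])
qed

lemma (in group) generate_singleton_subset:
  assumes "z \<in> carrier G" "x \<in> generate G {z}"
  shows "generate G {x} \<subseteq> generate G {z}"
  using assms generate_subgroup_incl[of "{x}" "generate G {z}"] generate_is_subgroup[of "{z}"]
  by simp

text \<open>Membership of \<open>x\<close> gives an inclusion of cyclic subgroups, which maximality
  turns into equality. Both halves of the theorem use this to derive structure from
  completeness.\<close>

lemma (in group) maximal_cyclic_subgroup_eqI:
  assumes "generate G {x} \<in> maximal_cyclic_subgroups G"
    and "z \<in> carrier G" "x \<in> generate G {z}"
  shows "generate G {z} = generate G {x}"
  using assms generate_singleton_subset[OF assms(2,3)]
  by (auto simp: maximal_cyclic_subgroups_def cyclic_subgroups_def)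

text \<open>There are finitely many cyclic subgroups, so some maximal one lies above
  \<open>generate G {x}\<close>.\<close>

lemma (in group) ex_maximal_cyclic_subgroup:
  assumes "finite (carrier G)" "x \<in> carrier G"
  shows "\<exists>H \<in> maximal_cyclic_subgroups G. x \<in> H"
proof -
  have "cyclic_subgroups G = (\<lambda>x. generate G {x}) ` carrier G"
    by (auto simp: cyclic_subgroups_def)
  then have "finite (cyclic_subgroups G)" "generate G {x} \<in> cyclic_subgroups G"
    using assms by simp_all
  then obtain H where H: "H \<in> cyclic_subgroups G" "generate G {x} \<subseteq> H"
      "\<forall>K \<in> cyclic_subgroups G. H \<subseteq> K \<longrightarrow> K = H"
    using finite_has_maximal2[of "cyclic_subgroups G" "generate G {x}"] by blast
  have "x \<in> generate G {x}"
    by (simp add: generate.incl)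
  with H show ?thesis
    by (auto simp: maximal_cyclic_subgroups_def)
qed

lemma (in group) complete_iff_card_essential_cyclic_set:
  assumes fin: "finite (carrier G)" and M: "essential_cyclic_set G M"
  shows "(\<forall>x \<in> carrier G. \<forall>y \<in> carrier G. \<exists>z \<in> carrier G.
            x \<in> generate G {z} \<and> y \<in> generate G {z}) \<longleftrightarrow> card M = 1"
proof
  have MG: "M \<subseteq> carrier G" and inj: "inj_on (\<lambda>x. generate G {x}) M"
    and img: "(\<lambda>x. generate G {x}) ` M = maximal_cyclic_subgroups G"
    using M by (auto simp: essential_cyclic_set_def bij_betw_def)
  {
    assume complete: "\<forall>x \<in> carrier G. \<forall>y \<in> carrier G. \<exists>z \<in> carrier G.
      x \<in> generate G {z} \<and> y \<in> generate G {z}"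
    have "x = y" if "x \<in> M" "y \<in> M" for x y
    proof -
      have "x \<in> carrier G" "y \<in> carrier G"
        using MG that by auto
      then obtain z where "z \<in> carrier G" "x \<in> generate G {z}" "y \<in> generate G {z}"
        using complete by meson
      moreover have "generate G {x} \<in> maximal_cyclic_subgroups G"
          "generate G {y} \<in> maximal_cyclic_subgroups G"
        using img that by blast+
      ultimately have "generate G {x} = generate G {y}"
        using maximal_cyclic_subgroup_eqI by metis
      then show ?thesis
        using inj that by (simp add: inj_on_def)
    qed
    \<comment> \<open>Any two elements of \<open>M\<close> being equal still allows the empty set; a
      maximal cyclic subgroup through \<open>\<one>\<close> excludes it.\<close>
    moreover have "M \<noteq> {}"
      using ex_maximal_cyclic_subgroup[OF fin one_closed] img by blast
    ultimately have "\<exists>x. M = {x}"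
      by blast
    then show "card M = 1"
      by auto
  next
    assume "card M = 1"
    then obtain z where z: "M = {z}"
      by (rule card_1_singletonE)
    then have "maximal_cyclic_subgroups G = {generate G {z}}"
      using img by auto
    \<comment> \<open>The maximal cyclic subgroup through \<open>x\<close> can only be
      \<open>generate G {z}\<close>, so the same \<open>z\<close> serves every pair.\<close>
    then have "x \<in> generate G {z}" if "x \<in> carrier G" for x
      using ex_maximal_cyclic_subgroup[OF fin that] by simp
    then show "\<forall>x \<in> carrier G. \<forall>y \<in> carrier G. \<exists>z \<in> carrier G.
        x \<in> generate G {z} \<and> y \<in> generate G {z}"
      using z MG by blast
  }
qed

lemma (in group) generate_involution:
  assumes "t \<in> carrier G" "ord t = 2"
  shows "generate G {t} = {\<one>, t}"
proof -
  have "t \<noteq> \<one>"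
    using assms by auto
  then have "card {\<one>, t} = card (generate G {t})"
    using assms generate_pow_card[of t] by auto
  moreover have "{\<one>, t} \<subseteq> generate G {t}"
    by (auto intro: generate.intros)
  \<comment> \<open>\<open>G\<close> may be infinite here, but \<open>card\<close> is 0 on infinite
    sets, while this subgroup has cardinality \<open>ord t = 2\<close>.\<close>
  moreover have "finite (generate G {t})"
    using assms generate_pow_card[of t] by (metis card.infinite zero_neq_numeral)
  ultimately show ?thesis
    using card_subset_eq by metis
qed

lemma (in group) iso_integer_mod_group_2:
  assumes "t \<in> carrier G" "ord t = 2" "carrier G = {\<one>, t}"
  shows "G \<cong> integer_mod_group 2"
proof -
  have t: "t \<noteq> \<one>" "t \<otimes> t = \<one>"
    using assms pow_ord_eq_1[of t] by (auto simp: numeral_2_eq_2)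
  have "{0..<2} = {0, 1 :: int}"
    by auto
  \<comment> \<open>The involution goes to the generator 1; \<open>t \<otimes> t = \<one>\<close>
    matches 1 + 1 = 0 modulo 2.\<close>
  with t have "(\<lambda>x. if x = t then 1 else 0) \<in> iso G (integer_mod_group 2)"
    using assms by (auto simp: iso_def hom_def bij_betw_def inj_on_def carrier_integer_mod_group)
  then show ?thesis
    by (auto simp: is_iso_def)
qed

text \<open>In a complete graph each element shares a cyclic subgroup with \<open>t\<close>, and by
  maximality this is \<open>{\<one>, t}\<close>. A group of order 2 is in turn generated by its
  involution.\<close>

lemma (in group) rainbow_connection_number_eq_one_iff_Z2:
  assumes fin: "finite (carrier G)" and t: "t \<in> maximal_involutions G"
  shows "rainbow_connection_number (enhanced_power_graph G) = 1 \<longleftrightarrow> G \<cong> integer_mod_group 2"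
proof
  have tG: "t \<in> carrier G" "ord t = 2" and max: "generate G {t} \<in> maximal_cyclic_subgroups G"
    using t by (auto simp: maximal_involutions_def)
  note gen = generate_involution[OF tG]
  {
    assume "rainbow_connection_number (enhanced_power_graph G) = 1"
    then have complete: "\<forall>x \<in> carrier G. \<forall>y \<in> carrier G. \<exists>z \<in> carrier G.
        x \<in> generate G {z} \<and> y \<in> generate G {z}"
      using rainbow_connection_number_enhanced_power_graph_eq_one_iff[OF fin] by simp
    have "x \<in> generate G {t}" if "x \<in> carrier G" for x
      using complete that tG maximal_cyclic_subgroup_eqI[OF max] by metis
    then have "carrier G = {\<one>, t}"
      using gen tG by auto
    then show "G \<cong> integer_mod_group 2"
      using iso_integer_mod_group_2 tG by blast
  next
    assume "G \<cong> integer_mod_group 2"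
    then have "card (carrier G) = 2"
      using iso_same_card[of G "integer_mod_group 2"] by (simp add: carrier_integer_mod_group)
    \<comment> \<open>Both sides have two elements and one contains the other; \<open>t\<close> then
      serves as the common \<open>z\<close> for all pairs.\<close>
    then have "generate G {t} = carrier G"
      using card_subset_eq[OF fin, of "generate G {t}"] generate_pow_card[of t]
        generate_incl[of "{t}"] tG by auto
    then show "rainbow_connection_number (enhanced_power_graph G) = 1"
      using rainbow_connection_number_enhanced_power_graph_eq_one_iff[OF fin] tG by auto
  }
qed

theorem theorem3p1:
  fixes G :: "('a, 'b) monoid_scheme" and M :: "'a set"
  assumes "group G" and "finite (carrier G)"
    and "essential_cyclic_set G M"
  shows "(icn G M = 1 \<longrightarrow>
            (rainbow_connection_number (enhanced_power_graph G) = 1 \<longleftrightarrow> card M = 1)) \<and>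
         (card (maximal_involutions G) = 1 \<longrightarrow>
            (rainbow_connection_number (enhanced_power_graph G) = 1 \<longleftrightarrow> G \<cong> integer_mod_group 2))"
proof -
  interpret group G by fact
  \<comment> \<open>Each side is equivalent to any two elements lying in a common cyclic
    subgroup.\<close>
  have "rainbow_connection_number (enhanced_power_graph G) = 1 \<longleftrightarrow> card M = 1"
    using rainbow_connection_number_enhanced_power_graph_eq_one_iff
      complete_iff_card_essential_cyclic_set assms(2,3) by blast
  \<comment> \<open>Cardinality 1 supplies the maximal involution \<open>t\<close> to which the
    previous lemma is applied.\<close>
  moreover have "rainbow_connection_number (enhanced_power_graph G) = 1 \<longleftrightarrow>
      G \<cong> integer_mod_group 2" if "card (maximal_involutions G) = 1"
    using that rainbow_connection_number_eq_one_iff_Z2[OF assms(2)]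
    by (metis card_1_singletonE insertI1)
  ultimately show ?thesis
    by blast
qed

end
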